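(* Let $n,N\ge 1$ be integers, let $Y\in\mathbb{R}^{n\times N}$, and let $\lambda,L$ be real numbers with $L>\lambda>0$. Let $(c^0,d^0)\in\mathbb{R}^N\times\mathbb{R}^n$ satisfy $\|d^0\|_2=1$ and $\|c^0\|_\infty\le L$. Let $\{c^t,d^t\}_{t\ge0}$ be the bounded iterate sequence generated by the SOUP-DIL Algorithm with a single atom ($J=1$), training data $Y$ and initial point $(c^0,d^0)$. Then every accumulation point of the iterate sequence is a critical point of the objective $f$, i.e., the iterates converge to the set of critical points of $f$ (the distance between $(c^t,d^t)$ and the set of critical points of $f$ converges to zero as $t\to\infty$).
   Context: Notation: $\|c\|_0$ is the number of non-zero entries of $c$. An accumulation point of a sequence is the limit of some subsequence. Objective for $J=1$: for $(c,d)\in\mathbb{R}^N\times\mathbb{R}^n$, $$f(c,d)=\|Y-dc^T\|_F^2+\lambda^2\|c\|_0+\chi(d)+\psi(c),$$ where $\chi(d)=0$ if $\|d\|_2=1$ and $+\infty$ otherwise, and $\psi(c)=0$ if $\|c\|_\infty\le L$ and $+\infty$ otherwise. Hard thresholding: for $b\in\mathbb{R}^N$, $(H_\lambda(b))_i=0$ if $|b_i|<\lambda$ and $(H_\lambda(b))_i=b_i$ if $|b_i|\ge\lambda$. $1_N$ is the all-ones vector of length $N$; $|\cdot|$, $\min$ and $\mathrm{sign}$ act entrywise on vectors; $\odot$ is the entrywise product; $v_1$ is the first column of the $n\times n$ identity matrix. SOUP-DIL Algorithm for $J=1$: given $(c^0,d^0)$, for $t=1,2,\dots$: (i) sparse coding: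 $b^t=Y^Td^{t-1}-c^{t-1}(d^{t-1})^Td^{t-1}+c^{t-1}$ (which equals $Y^Td^{t-1}$ since $\|d^{t-1}\|_2=1$) and $c^t=\min(|H_\lambda(b^t)|,L1_N)\odot\mathrm{sign}(H_\lambda(b^t))$; (ii) dictionary atom update: $h^t=Yc^t-d^{t-1}(c^{t-1})^Tc^t+d^{t-1}(c^{t-1})^Tc^t=Yc^t$, and $d^t=h^t/\|h^t\|_2$ if $c^t\neq0$, $d^t=v_1$ if $c^t=0$. Critical points: for $g:\mathbb{R}^p\to(-\infty,+\infty]$ proper (i.e. $\mathrm{dom}\,g=\{x:g(x)<+\infty\}\ne\emptyset$) and $x\in\mathrm{dom}\,g$, the Fréchet sub-differential is $$\hat\partial g(x)=\Big\{h\in\mathbb{R}^p:\liminf_{b\to x,\,b\ne x}\tfrac{1}{\|b-x\|}\big(g(b)-g(x)-\langle b-x,h\rangle\big)\ge0\Big\},$$ and $\hat\partial g(x)=\emptyset$ if $x\notin\mathrm{dom}\,g$. The sub-differential is $\partial g(x)=\{\tilde h\in\mathbb{R}^p:\exists\,x_k\to x,\ g(x_k)\to g(x),\ h_k\in\hat\partial g(x_k),\ h_k\to\tilde h\}$. Norm and inner product are Euclidean. $x$ is a critical point of $g$ if $0\in\partial g(x)$. *)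

theory Defs
  imports "HOL-Analysis.Analysis"
begin

definition frechet_subdiff :: "('a::euclidean_space \<Rightarrow> ereal) \<Rightarrow> 'a \<Rightarrow> 'a set" where
  "frechet_subdiff g x =
     (if g x < \<infinity>
      then {h. Liminf (at x) (\<lambda>b. ereal (1 / norm (b - x)) * (g b - g x - ereal ((b - x) \<bullet> h))) \<ge> 0}
      else {})"

definition subdiff :: "('a::euclidean_space \<Rightarrow> ereal) \<Rightarrow> 'a \<Rightarrow> 'a set" where
  "subdiff g x =
     {h'. \<exists>xs hs. xs \<longlonglongrightarrow> x \<and> (\<lambda>k. g (xs k)) \<longlonglongrightarrow> g x \<and>
                 (\<forall>k::nat. hs k \<in> frechet_subdiff g (xs k)) \<and> hs \<longlonglongrightarrow> h'}"

definition critical_point :: "('a::euclidean_space \<Rightarrow> ereal) \<Rightarrow> 'a \<Rightarrow> bool" where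
  "critical_point g x \<longleftrightarrow> 0 \<in> subdiff g x"

definition accumulation_point :: "(nat \<Rightarrow> 'a::topological_space) \<Rightarrow> 'a \<Rightarrow> bool" where
  "accumulation_point z p \<longleftrightarrow> (\<exists>r. strict_mono r \<and> (z \<circ> r) \<longlonglongrightarrow> p)"

(* Since infdist x {} = 0 in the library, nonemptiness of the target is required explicitly. *)
definition converges_to_set :: "(nat \<Rightarrow> 'a::metric_space) \<Rightarrow> 'a set \<Rightarrow> bool" where
  "converges_to_set z S \<longleftrightarrow> S \<noteq> {} \<and> (\<lambda>t. infdist (z t) S) \<longlonglongrightarrow> 0"

(* The matrix d c^T. *)
definition outer :: "real^'n \<Rightarrow> real^'N \<Rightarrow> real^'N^'n" where
  "outer d c = (\<chi> i j. d $ i * c $ j)"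

definition l0_norm :: "real^'N \<Rightarrow> nat" where
  "l0_norm c = card {i. c $ i \<noteq> 0}"

(* Extended-real indicator of a constraint, used for the unit sphere and the box terms. *)
definition barrier :: "bool \<Rightarrow> ereal" where
  "barrier P = (if P then 0 else \<infinity>)"

(* The norm on real^'N^'n is the Euclidean norm of the vector of Euclidean row norms,
   i.e. the Frobenius norm; infnorm is the maximum of the absolute values of the entries.
   The norm and inner product on the product type are the Euclidean ones. *)
definition objective :: "real^'N^'n \<Rightarrow> real \<Rightarrow> real \<Rightarrow> (real^'N) \<times> (real^'n) \<Rightarrow> ereal" where
  "objective Y lam L = (\<lambda>(c, d).
     ereal ((norm (Y - outer d c))\<^sup>2 + lam\<^sup>2 * real (l0_norm c))
       + barrier (norm d = 1) + barrier (infnorm c \<le> L))"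

definition hard_threshold :: "real \<Rightarrow> real^'N \<Rightarrow> real^'N" where
  "hard_threshold lam b = (\<chi> i. if \<bar>b $ i\<bar> < lam then 0 else b $ i)"

definition sparse_coding ::
    "real^'N^'n \<Rightarrow> real \<Rightarrow> real \<Rightarrow> real^'N \<Rightarrow> real^'n \<Rightarrow> real^'N" where
  "sparse_coding Y lam L c d =
     (let b = transpose Y *v d - (d \<bullet> d) *\<^sub>R c + c;
          s = hard_threshold lam b
      in \<chi> i. min \<bar>s $ i\<bar> L * sgn (s $ i))"

(* The arguments are the old code c, the old atom d and the new code c'.
   The row index k marks the first coordinate, so that axis k 1 is the first column of the
   identity matrix; the index type 'n carries no order, hence the explicit argument. *)
definition atom_update ::
    "real^'N^'n \<Rightarrow> 'n \<Rightarrow> real^'N \<Rightarrow> real^'n \<Rightarrow> real^'N \<Rightarrow> real^'n" where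
  "atom_update Y k c d c' =
     (let h = Y *v c' - (c \<bullet> c') *\<^sub>R d + (c \<bullet> c') *\<^sub>R d
      in if c' = 0 then axis k 1 else (1 / norm h) *\<^sub>R h)"

primrec soup_dil ::
    "real^'N^'n \<Rightarrow> real \<Rightarrow> real \<Rightarrow> 'n \<Rightarrow> real^'N \<Rightarrow> real^'n \<Rightarrow> nat \<Rightarrow> (real^'N) \<times> (real^'n)" where
  "soup_dil Y lam L k c0 d0 0 = (c0, d0)"
| "soup_dil Y lam L k c0 d0 (Suc t) =
     (let (c, d) = soup_dil Y lam L k c0 d0 t;
          c' = sparse_coding Y lam L c d
      in (c', atom_update Y k c d c'))"

end

theory Submission
  imports Defs
begin

text \<open>
  On the constraint set the objective equals \<open>\<parallel>Y\<parallel>\<^sup>2 + \<Phi>(c, d)\<close> with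
  \<open>\<Phi>(c, d) = \<parallel>c\<parallel>\<^sup>2 + \<lambda>\<^sup>2\<parallel>c\<parallel>\<^sub>0 - 2\<langle>c, Y\<^sup>T d\<rangle>\<close>, which couples \<open>c\<close> and \<open>d\<close> only through a bilinear term.
  Both updates are exact minimisations of \<open>\<Phi>\<close> in one block, and the atom update gains
  \<open>\<parallel>Y c\<^sup>t\<parallel> \<parallel>d\<^sup>t - d\<^sup>t\<^sup>-\<^sup>1\<parallel>\<^sup>2\<close>. Nonzero entries of \<open>c\<^sup>t\<close> have modulus at least \<open>\<lambda>\<close>, so \<open>\<parallel>\<cdot>\<parallel>\<^sub>0\<close> is eventually
  constant along a convergent subsequence, and \<open>\<parallel>Y c\<^sup>t\<parallel>\<close> stays away from zero when the limit code
  is nonzero; hence \<open>d\<^sup>t - d\<^sup>t\<^sup>-\<^sup>1\<close> tends to zero along it and the limit minimises \<open>\<Phi>\<close> in each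
  block. The bilinear coupling then gives \<open>f(b) \<ge> f(p) - K \<parallel>b - p\<parallel>\<^sup>2\<close>, so zero is a Frechet
  subgradient. If the limit code is zero, it is a local minimiser because every nonzero entry
  costs \<open>\<lambda>\<^sup>2\<close>.
\<close>

section \<open>Reduction of the objective on the constraint set\<close>

definition reduced_objective :: "real^'N^'n \<Rightarrow> real \<Rightarrow> real^'N \<Rightarrow> real^'n \<Rightarrow> real" where
  "reduced_objective Y lam c d = c \<bullet> c + lam\<^sup>2 * real (l0_norm c) - 2 * (c \<bullet> (transpose Y *v d))"

lemma inner_transpose_mult: "c \<bullet> (transpose Y *v d) = (d::real^'n) \<bullet> ((Y::real^'N^'n) *v c)"
  by (metis dot_lmul_matrix inner_commute transpose_matrix_vector)

lemma inner_outer: "(Y::real^'N^'n) \<bullet> outer d c = d \<bullet> (Y *v c)"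
  by (simp add: inner_vec_def outer_def matrix_vector_mult_def sum_distrib_left algebra_simps)

lemma outer_mult: "outer d c *v c' = (c \<bullet> c') *\<^sub>R d"
  by (simp add: vec_eq_iff outer_def matrix_vector_mult_def inner_vec_def sum_distrib_left
      sum_distrib_right algebra_simps)

text \<open>Expansion of the Frobenius square. The unit norm of \<open>d\<close> frees the quadratic
  term from \<open>d\<close>, so that only a bilinear coupling remains.\<close>

lemma norm_diff_outer:
  fixes Y :: "real^'N^'n"
  assumes "norm d = 1"
  shows "(norm (Y - outer d c))\<^sup>2 = (norm Y)\<^sup>2 + c \<bullet> c - 2 * (c \<bullet> (transpose Y *v d))"
proof -
  have "d \<bullet> d = 1" using assms by (simp add: dot_square_norm)
  then have "outer d c \<bullet> outer d c = c \<bullet> c"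
    by (simp only: inner_outer outer_mult) simp
  then show ?thesis
    unfolding inner_transpose_mult power2_norm_eq_inner
    by (simp add: inner_diff_left inner_diff_right inner_outer[of Y] inner_commute[of "outer d c" Y])
qed

lemma objective_feasible:
  assumes "norm d = 1" "infnorm c \<le> L"
  shows "objective Y lam L (c, d) = ereal ((norm Y)\<^sup>2 + reduced_objective Y lam c d)"
  using assms by (simp add: objective_def barrier_def norm_diff_outer reduced_objective_def)

lemma objective_infeasible:
  assumes "\<not> (norm d = 1 \<and> infnorm c \<le> L)"
  shows "objective Y lam L (c, d) = \<infinity>"
  using assms by (auto simp: objective_def barrier_def)

lemma reduced_objective_lower_bound:
  assumes "norm d = 1"
  shows "- (norm Y)\<^sup>2 \<le> reduced_objective Y lam c d"
proof -
  have "0 \<le> (norm (Y - outer d c))\<^sup>2 + lam\<^sup>2 * real (l0_norm c)" by simp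
  then show ?thesis
    using assms by (simp add: norm_diff_outer reduced_objective_def)
qed

text \<open>Separability in the entries of \<open>c\<close> reduces the minimisation over codes at
  fixed \<open>d\<close> to scalar problems.\<close>

lemma reduced_objective_sum:
  "reduced_objective Y lam c d =
    (\<Sum>i\<in>UNIV. (c $ i)\<^sup>2 + lam\<^sup>2 * of_bool (c $ i \<noteq> 0) - 2 * (c $ i * (transpose Y *v d) $ i))"
proof -
  have "real (l0_norm c) = (\<Sum>i\<in>UNIV. of_bool (c $ i \<noteq> 0))"
    by (simp add: l0_norm_def)
  then show ?thesis
    by (simp add: reduced_objective_def inner_vec_def sum.distrib sum_subtractf
        sum_distrib_left power2_eq_square)
qed

lemma infnorm_le_iff: "infnorm (c::real^'N) \<le> L \<longleftrightarrow> (\<forall>i. \<bar>c $ i\<bar> \<le> L)"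
proof
  assume "infnorm c \<le> L"
  then show "\<forall>i. \<bar>c $ i\<bar> \<le> L"
    using component_le_infnorm_cart order_trans by blast
next
  assume "\<forall>i. \<bar>c $ i\<bar> \<le> L"
  then show "infnorm c \<le> L"
    unfolding infnorm_cart by (intro cSup_least) auto
qed

lemma subseq_compose_tendsto:
  fixes X :: "nat \<Rightarrow> 'a::topological_space"
  assumes "X \<longlonglongrightarrow> l" "strict_mono (r :: nat \<Rightarrow> nat)"
  shows "(\<lambda>j. X (r j)) \<longlonglongrightarrow> l"
  using LIMSEQ_subseq_LIMSEQ[OF assms] by (simp add: o_def)


section \<open>Critical points from quadratic lower bounds\<close>

text \<open>Divided by \<open>norm (b - x)\<close>, the quadratic loss is still of order
  \<open>norm (b - x)\<close> and vanishes in the limit. Constant sequences then carry the Frechet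
  subgradient zero into the limiting sub-differential.\<close>

lemma critical_point_if_quadratic_lower_bound:
  fixes g :: "'a::euclidean_space \<Rightarrow> ereal"
  assumes fin: "g x = ereal a"
    and ev: "\<forall>\<^sub>F b in nhds x. ereal (a - K * (norm (b - x))\<^sup>2) \<le> g b"
  shows "critical_point g x"
proof -
  let ?q = "\<lambda>b. ereal (1 / norm (b - x)) * (g b - g x - ereal ((b - x) \<bullet> 0))"
  have "\<forall>\<^sub>F b in at x. ereal (- K * norm (b - x)) \<le> ?q b"
    using ev unfolding eventually_at_filter
  proof eventually_elim
    case (elim b)
    show ?case
    proof
      assume "b \<noteq> x"
      then have n: "norm (b - x) > 0" by simp
      show "b \<in> UNIV \<longrightarrow> ereal (- K * norm (b - x)) \<le> ?q b"
      proof (cases "g b")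
        case (real r)
        then show ?thesis using elim n fin
          by (simp add: field_simps power2_eq_square)
      next
        case PInf
        then show ?thesis using n fin by simp
      next
        case MInf
        then show ?thesis using elim by simp
      qed
    qed
  qed
  moreover have "((\<lambda>b. ereal (- K * norm (b - x))) \<longlongrightarrow> ereal 0) (at x)"
    by (intro tendsto_ereal tendsto_eq_intros) auto
  then have "Liminf (at x) (\<lambda>b. ereal (- K * norm (b - x))) = 0"
    by (simp add: lim_imp_Liminf zero_ereal_def)
  ultimately have "Liminf (at x) ?q \<ge> 0"
    using Liminf_mono[of "\<lambda>b. ereal (- K * norm (b - x))" ?q "at x"] by simp
  then have "0 \<in> frechet_subdiff g x"
    using fin by (simp add: frechet_subdiff_def)
  then show ?thesis
    unfolding critical_point_def subdiff_def
    by (intro CollectI exI[of _ "\<lambda>_. x"] exI[of _ "\<lambda>_. 0"]) auto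
qed

text \<open>Treated separately because at a zero code the weight \<open>norm (Y *v c)\<close> no
  longer controls the atom steps. Near \<open>(0, d)\<close> the bilinear term stays below
  \<open>lam\<^sup>2\<close>, the least price of a nonzero code.\<close>

lemma critical_point_objective_zero:
  fixes Y :: "real^'N^'n"
  assumes lam: "0 < lam" and L: "0 \<le> L" and d: "norm d = 1"
  shows "critical_point (objective Y lam L) (0, d)"
proof (rule critical_point_if_quadratic_lower_bound[where K = 0])
  show "objective Y lam L (0, d) = ereal ((norm Y)\<^sup>2 + reduced_objective Y lam 0 d)"
    using d L by (intro objective_feasible) (auto simp: infnorm_le_iff)
  let ?G = "\<lambda>b::(real^'N)\<times>(real^'n). 2 * (fst b \<bullet> (transpose Y *v snd b))"
  have "isCont ?G (0, d)"
    by (intro continuous_intros bounded_linear.isCont[OF matrix_vector_mul_bounded_linear])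
  then have "(?G \<longlongrightarrow> ?G (0, d)) (nhds (0, d))"
    unfolding isCont_def by (rule tendsto_at_iff_tendsto_nhds[THEN iffD1])
  then have "\<forall>\<^sub>F b in nhds (0, d). ?G b < lam\<^sup>2"
    by (rule order_tendstoD) (use lam in simp)
  then show "\<forall>\<^sub>F b in nhds (0, d).
      ereal ((norm Y)\<^sup>2 + reduced_objective Y lam 0 d - 0 * (norm (b - (0, d)))\<^sup>2)
        \<le> objective Y lam L b"
  proof eventually_elim
    case (elim b)
    obtain c' d' where b: "b = (c', d')" by (cases b)
    have "0 \<le> reduced_objective Y lam c' d'"
    proof (cases "c' = 0")
      case True
      then show ?thesis by (simp add: reduced_objective_def l0_norm_def)
    next
      case False
      then have "l0_norm c' \<noteq> 0" by (auto simp: l0_norm_def vec_eq_iff)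
      then have "lam\<^sup>2 * 1 \<le> lam\<^sup>2 * real (l0_norm c')"
        by (intro mult_left_mono) auto
      moreover have "2 * (c' \<bullet> (transpose Y *v d')) < lam\<^sup>2"
        using elim by (simp add: b)
      ultimately show ?thesis
        unfolding reduced_objective_def using inner_ge_zero[of c'] by linarith
    qed
    moreover have "reduced_objective Y lam 0 d = 0"
      by (simp add: reduced_objective_def l0_norm_def)
    ultimately show ?case
      by (cases "norm d' = 1 \<and> infnorm c' \<le> L")
        (simp_all add: b objective_feasible objective_infeasible)
  qed
qed

text \<open>A joint move splits into a code move at fixed \<open>d\<close>, an atom move at fixed
  \<open>c\<close>, and a mixed term. The first two cannot lower the value; the mixed term is
  quadratic in the displacement, with \<open>K\<close> bounding the operator norm of
  \<open>transpose Y\<close>.\<close>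

lemma critical_point_objective_if_blockwise_minimal:
  fixes Y :: "real^'N^'n"
  assumes d: "norm d = 1" and c: "infnorm c \<le> L"
    and cmin: "\<And>c'. infnorm c' \<le> L \<Longrightarrow> reduced_objective Y lam c d \<le> reduced_objective Y lam c' d"
    and dmin: "\<And>d'. norm d' = 1 \<Longrightarrow> d' \<bullet> (Y *v c) \<le> d \<bullet> (Y *v c)"
  shows "critical_point (objective Y lam L) (c, d)"
proof -
  obtain K where K: "\<And>x. norm (transpose Y *v x) \<le> norm x * K" "K > 0"
    using bounded_linear.pos_bounded[OF matrix_vector_mul_bounded_linear[of "transpose Y"]] by blast
  have "ereal ((norm Y)\<^sup>2 + reduced_objective Y lam c d - 2 * K * (norm (b - (c, d)))\<^sup>2)
      \<le> objective Y lam L b" for b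
  proof -
    obtain c' d' where b: "b = (c', d')" by (cases b)
    show ?thesis
    proof (cases "norm d' = 1 \<and> infnorm c' \<le> L")
      case False
      then show ?thesis by (simp add: b objective_infeasible)
    next
      case True
      let ?u = "c' - c" and ?v = "d' - d"
      have "?u \<bullet> (transpose Y *v ?v) \<le> norm ?u * norm (transpose Y *v ?v)"
        by (rule norm_cauchy_schwarz)
      also have "\<dots> \<le> norm ?u * (norm ?v * K)"
        by (intro mult_left_mono K) simp
      also have "\<dots> \<le> norm (b - (c, d)) * (norm (b - (c, d)) * K)"
        using K(2) norm_fst_le[of ?u ?v] norm_snd_le[of ?v ?u]
        by (intro mult_mono) (auto simp: b)
      finally have "?u \<bullet> (transpose Y *v ?v) \<le> K * (norm (b - (c, d)))\<^sup>2"
        by (simp add: power2_eq_square mult_ac)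
      moreover have "reduced_objective Y lam c' d' = reduced_objective Y lam c' d
          - 2 * (c \<bullet> (transpose Y *v ?v)) - 2 * (?u \<bullet> (transpose Y *v ?v))"
        by (simp add: reduced_objective_def matrix_vector_mult_diff_distrib algebra_simps)
      moreover have "c \<bullet> (transpose Y *v ?v) \<le> 0"
        using dmin[of d'] True by (simp add: inner_transpose_mult inner_diff_left del: transpose_matrix_vector)
      ultimately show ?thesis
        using cmin[of c'] True by (simp add: b objective_feasible)
    qed
  qed
  then show ?thesis
    by (intro critical_point_if_quadratic_lower_bound[where g = "objective Y lam L"]
        always_eventually allI) (rule objective_feasible[OF d c])
qed


section \<open>The two update steps\<close>

text \<open>Up to the constant \<open>b\<^sup>2\<close>, the quantity compared is
  \<open>(c - b)\<^sup>2\<close> plus the price \<open>lam\<^sup>2\<close> of a nonzero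
  \<open>c\<close>. The three regimes have minimisers zero, \<open>b\<close>, and \<open>b\<close>
  clipped to modulus \<open>L\<close>.\<close>

lemma scalar_threshold_minimises:
  fixes b c lam L :: real
  assumes "0 < lam" "lam < L" "\<bar>c\<bar> \<le> L"
  defines "s \<equiv> (if \<bar>b\<bar> < lam then 0 else b)"
  defines "m \<equiv> min \<bar>s\<bar> L * sgn s"
  shows "m\<^sup>2 + lam\<^sup>2 * of_bool (m \<noteq> 0) - 2 * (m * b) \<le> c\<^sup>2 + lam\<^sup>2 * of_bool (c \<noteq> 0) - 2 * (c * b)"
proof -
  consider "\<bar>b\<bar> < lam" | "lam \<le> \<bar>b\<bar>" "\<bar>b\<bar> \<le> L" | "L < \<bar>b\<bar>" by linarith
  then show ?thesis
  proof cases
    case 1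
    then have "b\<^sup>2 \<le> lam\<^sup>2" using assms(1) by (simp add: abs_le_square_iff[symmetric])
    moreover have "0 \<le> (c - b)\<^sup>2" by simp
    ultimately show ?thesis using 1 by (auto simp: m_def s_def power2_diff)
  next
    case 2
    then have "lam\<^sup>2 \<le> b\<^sup>2" using assms(1) by (simp add: abs_le_square_iff[symmetric])
    moreover have "0 \<le> (c - b)\<^sup>2" by simp
    moreover have "m = b" using 2 by (simp add: m_def s_def abs_mult_sgn)
    ultimately show ?thesis
      by (cases "c = 0") (simp_all add: of_bool_def power2_diff, simp_all add: power2_eq_square)
  next
    case 3
    have m: "m = L * sgn b" "m \<noteq> 0" "m\<^sup>2 = L\<^sup>2" "m * b = L * \<bar>b\<bar>"
      using 3 assms by (auto simp: m_def s_def power_mult_distrib sgn_if)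
    \<comment> \<open>This bound and the next settle the competitor \<open>c = 0\<close>. For
      nonzero \<open>c\<close> the prices cancel, and the point of \<open>[0, L]\<close> nearest to
      \<open>\<bar>b\<bar>\<close> is \<open>L\<close>.\<close>
    have "lam\<^sup>2 \<le> L\<^sup>2" using assms by (simp add: power_mono)
    moreover have "L\<^sup>2 \<le> L * \<bar>b\<bar>"
      using 3 assms by (simp add: power2_eq_square)
    moreover have "(\<bar>b\<bar> - L)\<^sup>2 \<le> (\<bar>b\<bar> - \<bar>c\<bar>)\<^sup>2"
      using 3 assms by (intro power_mono) auto
    then have "L\<^sup>2 - 2 * (L * \<bar>b\<bar>) \<le> c\<^sup>2 - 2 * (\<bar>c\<bar> * \<bar>b\<bar>)"
      by (simp add: power2_diff algebra_simps)
    moreover have "c * b \<le> \<bar>c\<bar> * \<bar>b\<bar>"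
      by (metis abs_ge_self abs_mult)
    ultimately show ?thesis
      unfolding m(3,4) using m(2) by (cases "c = 0") auto
  qed
qed

text \<open>The terms in the old code cancel because \<open>d \<bullet> d = 1\<close>.\<close>

lemma sparse_coding_component:
  assumes "norm d = 1"
  shows "sparse_coding Y lam L c d $ i =
    (let b = (transpose Y *v d) $ i; s = (if \<bar>b\<bar> < lam then 0 else b) in min \<bar>s\<bar> L * sgn s)"
proof -
  have "d \<bullet> d = 1" using assms by (simp add: dot_square_norm)
  then show ?thesis by (simp add: sparse_coding_def hard_threshold_def Let_def)
qed

lemma sparse_coding_minimises:
  fixes Y :: "real^'N^'n"
  assumes "0 < lam" "lam < L" "norm d = 1" "infnorm c' \<le> L"
  shows "reduced_objective Y lam (sparse_coding Y lam L c d) d \<le> reduced_objective Y lam c' d"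
  unfolding reduced_objective_sum sparse_coding_component[OF assms(3)] Let_def
  using assms(4)
  by (intro sum_mono scalar_threshold_minimises[OF assms(1,2)]) (simp add: infnorm_le_iff)

lemma sparse_coding_infnorm:
  assumes "0 < lam" "lam < L" "norm d = 1"
  shows "infnorm (sparse_coding Y lam L c d) \<le> L"
  using assms by (auto simp: infnorm_le_iff sparse_coding_component Let_def abs_mult abs_sgn_eq)

text \<open>Clipping at \<open>L > lam\<close> cannot push a surviving entry below
  \<open>lam\<close>. This gap later freezes the support along convergent codes.\<close>

lemma sparse_coding_zero_or_ge:
  assumes "0 < lam" "lam < L" "norm d = 1"
  shows "sparse_coding Y lam L c d $ i = 0 \<or> lam \<le> \<bar>sparse_coding Y lam L c d $ i\<bar>"
  using assms by (auto simp: sparse_coding_component Let_def abs_mult abs_sgn_eq)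

text \<open>Each nonzero entry of \<open>c'\<close> has the sign of the matching entry of
  \<open>transpose Y *v d\<close> and at most its modulus. Consequently a nonzero code has
  \<open>Y *v c' \<noteq> 0\<close>, and the normalisation in the atom update is genuine.\<close>

lemma sparse_coding_correlation:
  fixes Y :: "real^'N^'n" and c :: "real^'N"
  assumes "0 < lam" "lam < L" "norm d = 1"
  defines "c' \<equiv> sparse_coding Y lam L c d"
  shows "c' \<bullet> c' \<le> d \<bullet> (Y *v c')"
proof -
  have "c' \<bullet> c' \<le> c' \<bullet> (transpose Y *v d)"
    unfolding inner_vec_def
  proof (rule sum_mono)
    fix i
    define b where "b = (transpose Y *v d) $ i"
    \<comment> \<open>The case of an entry clipped to \<open>- L\<close>.\<close>
    have "L * L \<le> - (L * b)" if "L < - b"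
      using that assms(1,2) mult_left_mono[of L "- b" L] by simp
    then show "c' $ i \<bullet> c' $ i \<le> c' $ i \<bullet> (transpose Y *v d) $ i"
      using assms(1-3)
      unfolding c'_def sparse_coding_component[OF assms(3)] Let_def b_def[symmetric]
      by (auto simp: sgn_if min_def abs_if split: if_splits)
  qed
  then show ?thesis by (simp only: inner_transpose_mult)
qed

lemma norm_eq_1_atom_update:
  assumes "c' \<noteq> 0 \<Longrightarrow> Y *v c' \<noteq> 0"
  shows "norm (atom_update Y k c d c') = 1"
  using assms by (auto simp: atom_update_def Let_def)

text \<open>Equality in Cauchy-Schwarz, so the update is optimal among unit vectors. Both sides
  vanish if \<open>Y *v c' = 0\<close>, in particular if \<open>c' = 0\<close>.\<close>

lemma atom_update_inner:
  "atom_update Y k c d c' \<bullet> (Y *v c') = norm (Y *v c')"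
  by (auto simp: atom_update_def Let_def dot_square_norm power2_eq_square)

text \<open>Equality in Cauchy-Schwarz forces \<open>h = norm h *\<^sub>R d'\<close>, while
  \<open>(norm (d' - d))\<^sup>2 = 2 - 2 * (d \<bullet> d')\<close> for unit vectors.\<close>

lemma unit_vector_gap:
  fixes d d' h :: "'a::real_inner"
  assumes "norm d = 1" "norm d' = 1" "d' \<bullet> h = norm h"
  shows "2 * (d \<bullet> h) + norm h * (norm (d' - d))\<^sup>2 = 2 * (d' \<bullet> h)"
proof -
  have "norm d' * norm h = d' \<bullet> h" using assms by simp
  then have "h = norm h *\<^sub>R d'"
    using norm_cauchy_schwarz_eq[of d' h] assms(2) by simp
  then have "d \<bullet> h = norm h * (d \<bullet> d')"
    by (metis inner_scaleR_right)
  moreover have "d \<bullet> d = 1" "d' \<bullet> d' = 1"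
    using assms by (simp_all add: dot_square_norm)
  then have "(norm (d' - d))\<^sup>2 = 2 - 2 * (d \<bullet> d')"
    by (simp add: power2_norm_eq_inner inner_diff_left inner_diff_right inner_commute[of d' d])
  ultimately show ?thesis using assms(3) by (simp add: right_diff_distrib)
qed


section \<open>Convergence of the iterates\<close>

locale soup_dil_run =
  fixes Y :: "real^'N^'n" and lam L :: real and k :: 'n
    and c0 :: "real^'N" and d0 :: "real^'n"
  assumes lam_pos: "0 < lam" and lam_less: "lam < L"
    and norm_d0: "norm d0 = 1" and infnorm_c0: "infnorm c0 \<le> L"
begin

definition code :: "nat \<Rightarrow> real^'N" where
  "code t = fst (soup_dil Y lam L k c0 d0 t)"

definition atom :: "nat \<Rightarrow> real^'n" where
  "atom t = snd (soup_dil Y lam L k c0 d0 t)"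

lemma code_Suc: "code (Suc t) = sparse_coding Y lam L (code t) (atom t)"
  by (simp add: code_def atom_def Let_def split: prod.split)

lemma atom_Suc: "atom (Suc t) = atom_update Y k (code t) (atom t) (code (Suc t))"
  by (simp add: code_def atom_def Let_def split: prod.split)

lemma norm_atom: "norm (atom t) = 1"
proof (induction t)
  case 0
  then show ?case by (simp add: atom_def norm_d0)
next
  case (Suc t)
  have "Y *v code (Suc t) \<noteq> 0" if "code (Suc t) \<noteq> 0"
  proof
    assume "Y *v code (Suc t) = 0"
    then have "code (Suc t) \<bullet> code (Suc t) \<le> 0"
      using sparse_coding_correlation[OF lam_pos lam_less Suc, of Y "code t"] by (simp add: code_Suc)
    with that show False by (simp add: inner_gt_zero_iff flip: not_less)
  qed
  then show ?case unfolding atom_Suc by (rule norm_eq_1_atom_update)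
qed

lemma infnorm_code: "infnorm (code t) \<le> L"
  by (cases t) (auto simp: code_Suc code_def[of 0] infnorm_c0 sparse_coding_infnorm
      lam_pos lam_less norm_atom)

lemma code_zero_or_ge: "code (Suc t) $ i = 0 \<or> lam \<le> \<bar>code (Suc t) $ i\<bar>"
  unfolding code_Suc by (rule sparse_coding_zero_or_ge[OF lam_pos lam_less norm_atom])

lemma code_minimises:
  "infnorm c \<le> L \<Longrightarrow>
    reduced_objective Y lam (code (Suc t)) (atom t) \<le> reduced_objective Y lam c (atom t)"
  unfolding code_Suc by (rule sparse_coding_minimises[OF lam_pos lam_less norm_atom])

lemma atom_inner: "atom (Suc t) \<bullet> (Y *v code (Suc t)) = norm (Y *v code (Suc t))"
  by (simp add: atom_Suc atom_update_inner)

text \<open>The old code is an admissible competitor in the code step; the atom step then gains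
  exactly the amount in \<open>unit_vector_gap\<close>.\<close>

lemma reduced_objective_decrease:
  "reduced_objective Y lam (code (Suc t)) (atom (Suc t))
      + norm (Y *v code (Suc t)) * (norm (atom (Suc t) - atom t))\<^sup>2
    \<le> reduced_objective Y lam (code t) (atom t)"
  using code_minimises[OF infnorm_code, of t t]
    unit_vector_gap[OF norm_atom norm_atom atom_inner, of t t]
  by (simp add: reduced_objective_def inner_transpose_mult del: transpose_matrix_vector)

text \<open>The values decrease and are bounded below, so their consecutive differences tend to
  zero; these dominate the weighted steps.\<close>

lemma atom_step_gap: "(\<lambda>t. norm (Y *v code (Suc t)) * (norm (atom (Suc t) - atom t))\<^sup>2) \<longlonglongrightarrow> 0"
proof -
  let ?F = "\<lambda>t. reduced_objective Y lam (code t) (atom t)"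
  have le: "norm (Y *v code (Suc t)) * (norm (atom (Suc t) - atom t))\<^sup>2 \<le> ?F t - ?F (Suc t)" for t
    using reduced_objective_decrease[of t] by simp
  have "?F (Suc t) \<le> ?F t" for t
    using le[of t] by (smt (verit) mult_nonneg_nonneg norm_ge_zero zero_le_power2)
  then have "decseq ?F" by (rule decseq_SucI)
  then obtain l where l: "?F \<longlonglongrightarrow> l"
    by (rule decseq_convergent[OF _ allI]) (rule reduced_objective_lower_bound[OF norm_atom])
  have "(\<lambda>t. ?F t - ?F (Suc t)) \<longlonglongrightarrow> l - l"
    by (rule tendsto_diff[OF l LIMSEQ_Suc[OF l]])
  then have "(\<lambda>t. ?F t - ?F (Suc t)) \<longlonglongrightarrow> 0" by simp
  then show ?thesis
    by (rule Lim_null_comparison[rotated]) (use le in simp)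
qed

lemma critical_if_subseq_tendsto:
  assumes r: "strict_mono r"
    and c: "(\<lambda>j. code (r j)) \<longlonglongrightarrow> c" and d: "(\<lambda>j. atom (r j)) \<longlonglongrightarrow> d"
  shows "critical_point (objective Y lam L) (c, d)"
proof -
  have norm_d: "norm d = 1"
    using tendsto_norm[OF d] by (simp add: norm_atom LIMSEQ_const_iff)
  have infnorm_c: "infnorm c \<le> L"
    unfolding infnorm_le_iff
  proof
    fix i
    have "(\<lambda>j. \<bar>code (r j) $ i\<bar>) \<longlonglongrightarrow> \<bar>c $ i\<bar>" by (intro tendsto_intros c)
    then show "\<bar>c $ i\<bar> \<le> L"
      by (rule LIMSEQ_le_const2) (use infnorm_code in \<open>auto simp: infnorm_le_iff\<close>)
  qed
  show ?thesis
  proof (cases "c = 0")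
    case True
    then show ?thesis
      using critical_point_objective_zero[OF lam_pos _ norm_d, of L Y] lam_pos lam_less by simp
  next
    case False
    \<comment> \<open>\<open>code (Suc t)\<close> is optimal against \<open>atom t\<close>, so
      predecessor indices are needed. Starting from \<open>r (Suc j) > 0\<close> keeps the natural
      subtraction exact.\<close>
    define q where "q j = r (Suc j) - 1" for j
    have q: "r (Suc j) = Suc (q j)" for j
      using strict_monoD[OF r, of 0 "Suc j"] by (simp add: q_def)
    have q_mono: "strict_mono q"
      unfolding strict_mono_Suc_iff
    proof
      fix j show "q j < q (Suc j)"
        using strict_monoD[OF r, of "Suc j" "Suc (Suc j)"] by (simp add: q)
    qed
    have c': "(\<lambda>j. code (Suc (q j))) \<longlonglongrightarrow> c" and d': "(\<lambda>j. atom (Suc (q j))) \<longlonglongrightarrow> d"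
      using LIMSEQ_Suc[OF c] LIMSEQ_Suc[OF d] by (simp_all add: q)
    note mv [tendsto_intros] = bounded_linear.tendsto[OF matrix_vector_mul_bounded_linear]
    \<comment> \<open>Passing to the limit in the code optimality requires convergence of the
      discontinuous count. An entry with limit zero eventually drops below \<open>lam\<close>, hence
      vanishes by \<open>code_zero_or_ge\<close>.\<close>
    have supp: "\<forall>\<^sub>F j in sequentially. \<forall>i. code (Suc (q j)) $ i = 0 \<longleftrightarrow> c $ i = 0"
    proof (rule eventually_all_finite)
      fix i
      have lim: "(\<lambda>j. code (Suc (q j)) $ i) \<longlonglongrightarrow> c $ i" by (intro tendsto_intros c')
      show "\<forall>\<^sub>F j in sequentially. code (Suc (q j)) $ i = 0 \<longleftrightarrow> c $ i = 0"
      proof (cases "c $ i = 0")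
        case True
        have "\<forall>\<^sub>F j in sequentially. dist (code (Suc (q j)) $ i) 0 < lam"
          using lim True lam_pos by (auto dest: tendstoD)
        then show ?thesis
          by eventually_elim (use code_zero_or_ge True in \<open>fastforce simp: dist_real_def\<close>)
      next
        case ne: False
        show ?thesis
          using tendsto_imp_eventually_ne[OF lim ne] by eventually_elim (use ne in simp)
      qed
    qed
    then have l0: "\<forall>\<^sub>F j in sequentially. l0_norm (code (Suc (q j))) = l0_norm c"
      by eventually_elim (simp add: l0_norm_def)
    have corr: "code (Suc t) \<bullet> code (Suc t) \<le> norm (Y *v code (Suc t))" for t
      using sparse_coding_correlation[OF lam_pos lam_less norm_atom[of t], of Y "code t"]
        norm_cauchy_schwarz[of "atom t" "Y *v code (Suc t)"]
      by (simp add: code_Suc norm_atom)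
    have "(\<lambda>j. (norm (atom (Suc (q j)) - atom (q j)))\<^sup>2) \<longlonglongrightarrow> 0"
    proof -
      have lim_n: "(\<lambda>j. norm (Y *v code (Suc (q j)))) \<longlonglongrightarrow> norm (Y *v c)"
        by (intro tendsto_intros c')
      \<comment> \<open>The correlation bound survives the limit, so the weight in
        \<open>atom_step_gap\<close> has a nonzero limit and can be divided out.\<close>
      have "c \<bullet> c \<le> norm (Y *v c)"
        by (rule LIMSEQ_le[OF tendsto_inner[OF c' c'] lim_n]) (use corr in auto)
      then have ne: "norm (Y *v c) \<noteq> 0"
        using False by (smt (verit) inner_gt_zero_iff)
      have "(\<lambda>j. norm (Y *v code (Suc (q j))) * (norm (atom (Suc (q j)) - atom (q j)))\<^sup>2
          / norm (Y *v code (Suc (q j)))) \<longlonglongrightarrow> 0 / norm (Y *v c)"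
        by (intro tendsto_divide subseq_compose_tendsto[OF atom_step_gap q_mono] lim_n ne)
      moreover have "\<forall>\<^sub>F j in sequentially. norm (Y *v code (Suc (q j))) \<noteq> 0"
        by (rule tendsto_imp_eventually_ne[OF lim_n ne])
      ultimately show ?thesis
        by (rule_tac Lim_transform_eventually) (auto elim: eventually_mono)
    qed
    then have "(\<lambda>j. sqrt ((norm (atom (Suc (q j)) - atom (q j)))\<^sup>2)) \<longlonglongrightarrow> sqrt 0"
      by (rule tendsto_real_sqrt)
    then have "(\<lambda>j. atom (Suc (q j)) - atom (q j)) \<longlonglongrightarrow> 0"
      by (simp add: tendsto_norm_zero_iff)
    \<comment> \<open>Old and new atoms share the limit \<open>d\<close>, so optimality of the codes
      against the old atoms becomes optimality of \<open>c\<close> against \<open>d\<close>.\<close>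
    from tendsto_diff[OF d' this] have dq: "(\<lambda>j. atom (q j)) \<longlonglongrightarrow> d" by simp
    show ?thesis
    proof (rule critical_point_objective_if_blockwise_minimal[OF norm_d infnorm_c])
      fix c2 :: "real^'N"
      assume c2: "infnorm c2 \<le> L"
      have "(\<lambda>j. code (Suc (q j)) \<bullet> code (Suc (q j)) + lam\<^sup>2 * real (l0_norm c)
          - 2 * (code (Suc (q j)) \<bullet> (transpose Y *v atom (q j))))
          \<longlonglongrightarrow> reduced_objective Y lam c d"
        unfolding reduced_objective_def by (intro tendsto_intros c' dq)
      then have "(\<lambda>j. reduced_objective Y lam (code (Suc (q j))) (atom (q j)))
          \<longlonglongrightarrow> reduced_objective Y lam c d"
        by (rule Lim_transform_eventually)
          (use l0 in \<open>eventually_elim, simp add: reduced_objective_def\<close>)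
      moreover have "(\<lambda>j. reduced_objective Y lam c2 (atom (q j)))
          \<longlonglongrightarrow> reduced_objective Y lam c2 d"
        unfolding reduced_objective_def by (intro tendsto_intros dq)
      ultimately show "reduced_objective Y lam c d \<le> reduced_objective Y lam c2 d"
        by (rule LIMSEQ_le) (use code_minimises[OF c2] in auto)
    next
      fix d2 :: "real^'n"
      assume d2: "norm d2 = 1"
      have "d2 \<bullet> (Y *v code (Suc (q j))) \<le> atom (Suc (q j)) \<bullet> (Y *v code (Suc (q j)))" for j
        using norm_cauchy_schwarz[of d2 "Y *v code (Suc (q j))"] d2 by (simp add: atom_inner)
      moreover have "(\<lambda>j. d2 \<bullet> (Y *v code (Suc (q j)))) \<longlonglongrightarrow> d2 \<bullet> (Y *v c)"
        "(\<lambda>j. atom (Suc (q j)) \<bullet> (Y *v code (Suc (q j)))) \<longlonglongrightarrow> d \<bullet> (Y *v c)"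
        by (intro tendsto_intros c' d')+
      ultimately show "d2 \<bullet> (Y *v c) \<le> d \<bullet> (Y *v c)"
        by (meson LIMSEQ_le)
    qed
  qed
qed

lemma bounded_iterates: "bounded (range (soup_dil Y lam L k c0 d0))"
proof -
  have "bounded {c::real^'N. \<forall>i. \<bar>c $ i\<bar> \<le> L}"
    using bounded_cbox[of "(\<chi> i. - L)::real^'N" "\<chi> i. L"]
    by (rule bounded_subset) (auto simp: mem_box_cart abs_le_iff minus_le_iff)
  moreover have "bounded {d::real^'n. norm d = 1}"
    by (rule boundedI[of _ 1]) auto
  ultimately have "bounded ({c::real^'N. \<forall>i. \<bar>c $ i\<bar> \<le> L} \<times> {d::real^'n. norm d = 1})"
    by (rule bounded_Times)
  moreover have "range (soup_dil Y lam L k c0 d0) \<subseteq>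
      {c::real^'N. \<forall>i. \<bar>c $ i\<bar> \<le> L} \<times> {d::real^'n. norm d = 1}"
  proof
    fix p assume "p \<in> range (soup_dil Y lam L k c0 d0)"
    then obtain t where "p = (code t, atom t)" by (auto simp: code_def atom_def)
    then show "p \<in> {c. \<forall>i. \<bar>c $ i\<bar> \<le> L} \<times> {d. norm d = 1}"
      using infnorm_code[of t] norm_atom[of t] by (simp add: infnorm_le_iff)
  qed
  ultimately show ?thesis by (rule bounded_subset)
qed

lemma critical_if_accumulation_point:
  assumes "accumulation_point (soup_dil Y lam L k c0 d0) p"
  shows "critical_point (objective Y lam L) p"
proof -
  obtain r where r: "strict_mono r" and lim: "(soup_dil Y lam L k c0 d0 \<circ> r) \<longlonglongrightarrow> p"
    using assms by (auto simp: accumulation_point_def)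
  show ?thesis
    using critical_if_subseq_tendsto[OF r, of "fst p" "snd p"] tendsto_fst[OF lim] tendsto_snd[OF lim]
    by (simp add: code_def atom_def o_def)
qed

end

text \<open>Otherwise infinitely many terms stay at distance at least some \<open>e > 0\<close> from
  \<open>S\<close>. By boundedness a subsequence of them converges, and its limit lies in
  \<open>S\<close>, a contradiction.\<close>

lemma converges_to_set_if_bounded:
  fixes z :: "nat \<Rightarrow> 'a::heine_borel"
  assumes bdd: "bounded (range z)" and acc: "\<And>p. accumulation_point z p \<Longrightarrow> p \<in> S"
  shows "converges_to_set z S"
proof -
  have ex: "\<exists>p\<in>S. \<exists>s. strict_mono s \<and> (\<lambda>j. z (r (s j))) \<longlonglongrightarrow> p" if r: "strict_mono r" for r :: "nat \<Rightarrow> nat"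
  proof -
    have "bounded (range (z \<circ> r))" using bdd by (rule bounded_subset) auto
    then obtain p s where s: "strict_mono s" and lim: "((z \<circ> r) \<circ> s) \<longlonglongrightarrow> p"
      using bounded_imp_convergent_subsequence by metis
    have "accumulation_point z p"
      unfolding accumulation_point_def
      using strict_mono_o[OF r s] lim by (auto simp: o_assoc)
    then show ?thesis using acc s lim by (auto simp: o_def)
  qed
  \<comment> \<open>Applied to the whole sequence, compactness already yields a point of
    \<open>S\<close>.\<close>
  have "S \<noteq> {}" using ex[of id] by (auto simp: strict_mono_def)
  moreover have "(\<lambda>t. infdist (z t) S) \<longlonglongrightarrow> 0"
  proof (rule ccontr)
    assume "\<not> ?thesis"
    then obtain e where e: "e > 0" and "\<not> (\<forall>\<^sub>F t in sequentially. dist (infdist (z t) S) 0 < e)"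
      by (auto simp: tendsto_iff)
    then have "infinite {t. e \<le> infdist (z t) S}"
      by (simp add: not_eventually frequently_cofinite[symmetric] cofinite_eq_sequentially
          infdist_nonneg dist_real_def not_less)
    then obtain r :: "nat \<Rightarrow> nat" where r: "strict_mono r" and far: "\<And>j. e \<le> infdist (z (r j)) S"
      using infinite_enumerate by (metis mem_Collect_eq)
    obtain p s where p: "p \<in> S" and lim: "(\<lambda>j. z (r (s j))) \<longlonglongrightarrow> p"
      using ex[OF r] by blast
    have "(\<lambda>j. infdist (z (r (s j))) S) \<longlonglongrightarrow> infdist p S" by (rule tendsto_infdist[OF lim])
    then have "e \<le> infdist p S" by (rule LIMSEQ_le_const) (use far in auto)
    with p e show False by simp
  qed
  ultimately show ?thesis by (simp add: converges_to_set_def)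
qed

theorem theorem2:
  fixes Y :: "real^'N^'n" and lam L :: real and k :: 'n
    and c0 :: "real^'N" and d0 :: "real^'n"
  assumes "0 < lam" and "lam < L"
    and "norm d0 = 1" and "infnorm c0 \<le> L"
  shows "bounded (range (soup_dil Y lam L k c0 d0))
    \<and> (\<forall>p. accumulation_point (soup_dil Y lam L k c0 d0) p
            \<longrightarrow> critical_point (objective Y lam L) p)
    \<and> converges_to_set (soup_dil Y lam L k c0 d0)
        {p. critical_point (objective Y lam L) p}"
proof -
  interpret soup_dil_run Y lam L k c0 d0
    using assms by unfold_locales
  show ?thesis
    using bounded_iterates critical_if_accumulation_point
    by (simp add: converges_to_set_if_bounded)
qed

end
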